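(* Let the iterates be generated by algorithm iRPMVR, with exact tangent steps $\hat\eta^k$. Then there exist constants $C_1,C_2>0$, independent of $k$ and $n$, such that for all $k\ge0$ $$\|B_{x^k}w^k\|\le\Delta_k,\qquad\|w^k-\eta^k\|\le C_0\Delta_k,\qquad\|\eta^k-\hat\eta^k\|\le C_1\sqrt{\Delta_k},\qquad\|w^k-\hat\eta^k\|\le C_2\sqrt{\Delta_k}.$$
   Context: Setting. $\mathcal M\subseteq\mathbb R^d$ is a compact embedded Riemannian submanifold (induced Euclidean metric) of dimension $d-p$, with tangent spaces $T_x\mathcal M$, tangent bundle $T\mathcal M=\{(x,\eta):x\in\mathcal M,\eta\in T_x\mathcal M\}$; $P_S$ is Euclidean projection onto a closed convex set $S$. $F=\frac1n\sum_{j=1}^nf_j$. Each $f_j:\mathbb R^d\to\mathbb R$ is $C^1$; there is an open neighborhood $U$ of $\mathcal M$ on which every $\nabla f_j$ is Lipschitz with common constant $\ell_f$; $\|\nabla f_j(x)\|\le M_f$ for all $x\in\mathcal M$ and all $j$ ($M_f>0$ independent of $n$); $R:\mathbb R^d\to\mathbb R$ is convex and $\ell_R$-Lipschitz. $\operatorname{grad}h(x)=P_{T_x\mathcal M}\nabla h(x)$. $\operatorname{Retr}:T\mathcal M\to\mathcal M$ is a retraction (smooth, $\operatorname{Retr}_x(0)=x$, $D\operatorname{Retr}_x(0)=\mathrm{Id}$). $\mathcal M$ is covered by finitely many open sets $V_\ell$ with $\overline{V_\ell}\subseteq U_\ell$, $U_\ell$ open carrying smooth local defining functions $\psi_\ell:U_\ell\to\mathbb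 R^p$ of $\mathcal M$ whose differential has full row rank on $U_\ell\cap\mathcal M$; for $x\in\mathcal M$ pick $\ell(x)$ with $x\in V_{\ell(x)}$ and set $B_x:=D\psi_{\ell(x)}(x)$, so $\ker B_x=T_x\mathcal M$. $C_0>0$ is a constant with $\operatorname{dist}(v,T_x\mathcal M)\le C_0\|B_xv\|$ for all $x\in\mathcal M$, $v\in\mathbb R^d$. Algorithm iRPMVR. Choose $x^0\in\mathcal M$, stepsize $0<\alpha\le\bar\alpha$, $0<\gamma\le1$, $\bar\Delta\ge0$, $0\le\bar\chi<1$, $M_u:=c_fM_f$ with $c_f\ge1$. Parameters $\gamma_k\in[\gamma,1]$, $\Delta_k\in[0,\bar\Delta]$, $\chi_k\in[0,\bar\chi]$ are chosen before sampling the $k$-th batch using only available history. Initialize $u^0=\hat u^0=\bar m^0=\operatorname{grad}F(x^0)$. For $k=0,1,\dots$: (a) if $k\ne0$, sample a random batch $\mathcal B_k$ from $\{1,\dots,n\}$, form from it and the current estimator state an estimator $u^k\in T_{x^k}\mathcal M$ of $\operatorname{grad}F(x^k)$, and set $\hat u^k=P_{\overline B(0,M_u)}u^k$; (b) $m^k=\chi_k\bar m^k+(1-\chi_k)\hat u^k$; (c) with $F_k(\eta):=\langle m^k,\eta\rangle+\frac1{2\alpha}\|\eta\|^2+R(x^k+\eta)$ and $G_k(\lambda):=F_k^*(-B_{x^k}^\top\lambda)$ ($F_k^*$ the Fenchel conjugate) find $\lambda^k\in\mathbb R^p$ with $\|\nabla G_k(\lambda^k)\|\le\Delta_k$; (d)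 $w^k=\operatorname{prox}_{\alpha R}(x^k-\alpha(m^k+B_{x^k}^\top\lambda^k))-x^k$, where $\operatorname{prox}_{\alpha R}(x)=\arg\min_y\{R(y)+\frac1{2\alpha}\|y-x\|^2\}$, and $\eta^k=P_{T_{x^k}\mathcal M}w^k$; (e) $x^{k+1}=\operatorname{Retr}_{x^k}(\gamma_k\eta^k)$; (f) $\bar m^{k+1}=P_{T_{x^{k+1}}\mathcal M}m^k$. The exact tangent step is $\hat\eta^k:=\arg\min_{\eta\in T_{x^k}\mathcal M}F_k(\eta)$. *)

theory Defs
  imports "HOL-Analysis.Analysis" "HOL-Probability.Probability"
begin

section \<open>Smooth maps and gradients\<close>

text \<open>Only meant for open \<open>S\<close>, where the full derivative \<open>at x\<close> is the right one.\<close>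

primrec Ck_on :: "nat \<Rightarrow> 'a::real_normed_vector set \<Rightarrow> ('a \<Rightarrow> 'b::real_normed_vector) \<Rightarrow> bool" where
  "Ck_on 0 S f \<longleftrightarrow> continuous_on S f"
| "Ck_on (Suc k) S f \<longleftrightarrow>
     (\<forall>x\<in>S. f differentiable (at x)) \<and>
     (\<forall>v. Ck_on k S (\<lambda>x. frechet_derivative f (at x) v))"

definition smooth_on :: "'a::real_normed_vector set \<Rightarrow> ('a \<Rightarrow> 'b::real_normed_vector) \<Rightarrow> bool" where
  "smooth_on S f \<longleftrightarrow> (\<forall>k. Ck_on k S f)"

text \<open>Smoothness of a map on an embedded submanifold \<open>S\<close> (which is not open in general): near each
  point it is the restriction of a smooth map defined on an open subset of the ambient space.\<close>

definition smooth_map_on :: "'a::real_normed_vector set \<Rightarrow> ('a \<Rightarrow> 'b::real_normed_vector) \<Rightarrow> bool" where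
  "smooth_map_on S f \<longleftrightarrow>
     (\<forall>x\<in>S. \<exists>W g. open W \<and> x \<in> W \<and> smooth_on W g \<and> (\<forall>y\<in>S \<inter> W. g y = f y))"

definition gradient :: "('a::real_inner \<Rightarrow> real) \<Rightarrow> 'a \<Rightarrow> 'a" where
  "gradient h x = (THE D. GDERIV h x :> D)"

section \<open>Embedded submanifolds of Euclidean space\<close>

definition local_defining_function ::
  "(real^'d) set \<Rightarrow> (real^'d) set \<Rightarrow> (real^'d \<Rightarrow> real^'p) \<Rightarrow> bool" where
  "local_defining_function M U \<psi> \<longleftrightarrow>
     open U \<and> smooth_on U \<psi> \<and> M \<inter> U = {x \<in> U. \<psi> x = 0} \<and>
     (\<forall>x\<in>U \<inter> M. rank (jacobian \<psi> (at x)) = CARD('p))"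

text \<open>The codimension is carried by the index type \<open>'p\<close>: a set satisfying this predicate has
  dimension \<open>CARD('d) - CARD('p)\<close>.\<close>

definition embedded_submanifold :: "'p::finite itself \<Rightarrow> (real^'d) set \<Rightarrow> bool" where
  "embedded_submanifold _ M \<longleftrightarrow>
     (\<forall>x\<in>M. \<exists>U (\<psi> :: real^'d \<Rightarrow> real^'p). x \<in> U \<and> local_defining_function M U \<psi>)"

text \<open>Velocities at \<open>x\<close> of curves running in \<open>M\<close>.\<close>

definition tangent_space :: "'a::real_normed_vector set \<Rightarrow> 'a \<Rightarrow> 'a set" where
  "tangent_space M x =
     {v. \<exists>c \<epsilon>. \<epsilon> > 0 \<and> c C1_differentiable_on {-\<epsilon><..<\<epsilon>} \<and> c ` {-\<epsilon><..<\<epsilon>} \<subseteq> M \<and>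
           c 0 = x \<and> (c has_vector_derivative v) (at 0)}"

definition tangent_bundle :: "'a::real_normed_vector set \<Rightarrow> ('a \<times> 'a) set" where
  "tangent_bundle M = {(x, \<eta>). x \<in> M \<and> \<eta> \<in> tangent_space M x}"

definition riemannian_grad :: "(real^'d) set \<Rightarrow> (real^'d \<Rightarrow> real) \<Rightarrow> real^'d \<Rightarrow> real^'d" where
  "riemannian_grad M h x = closest_point (tangent_space M x) (gradient h x)"

text \<open>\<open>Retr x \<eta>\<close> only matters for \<open>(x, \<eta>)\<close> in the tangent bundle. The last conjunct says that the
  differential of \<open>Retr x\<close>, as a map on the tangent space at \<open>x\<close>, is the identity at \<open>0\<close>.\<close>

definition manifold_retraction ::
  "(real^'d) set \<Rightarrow> (real^'d \<Rightarrow> real^'d \<Rightarrow> real^'d) \<Rightarrow> bool" where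
  "manifold_retraction M Retr \<longleftrightarrow>
     (\<forall>(x, \<eta>)\<in>tangent_bundle M. Retr x \<eta> \<in> M) \<and>
     smooth_map_on (tangent_bundle M) (\<lambda>(x, \<eta>). Retr x \<eta>) \<and>
     (\<forall>x\<in>M. Retr x 0 = x \<and>
        (Retr x has_derivative (\<lambda>v. v)) (at 0 within tangent_space M x))"

text \<open>A finite cover of \<open>M\<close> by open sets \<open>V i\<close> whose closures lie in domains \<open>U i\<close> of local defining
  functions \<open>\<psi> i\<close>, together with a choice \<open>\<l> x\<close> of an index with \<open>x \<in> V (\<l> x)\<close>.\<close>

definition defining_cover ::
  "(real^'d) set \<Rightarrow> 'i set \<Rightarrow> ('i \<Rightarrow> (real^'d) set) \<Rightarrow> ('i \<Rightarrow> (real^'d) set) \<Rightarrow>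
   ('i \<Rightarrow> real^'d \<Rightarrow> real^'p) \<Rightarrow> (real^'d \<Rightarrow> 'i) \<Rightarrow> bool" where
  "defining_cover M I V U \<psi> \<l> \<longleftrightarrow>
     finite I \<and> M \<subseteq> (\<Union>i\<in>I. V i) \<and>
     (\<forall>i\<in>I. open (V i) \<and> closure (V i) \<subseteq> U i \<and> local_defining_function M (U i) (\<psi> i)) \<and>
     (\<forall>x\<in>M. \<l> x \<in> I \<and> x \<in> V (\<l> x))"

definition defining_jacobian ::
  "('i \<Rightarrow> real^'d \<Rightarrow> real^'p) \<Rightarrow> (real^'d \<Rightarrow> 'i) \<Rightarrow> real^'d \<Rightarrow> real^'d^'p" where
  "defining_jacobian \<psi> \<l> x = jacobian (\<psi> (\<l> x)) (at x)"

section \<open>The finite-sum objective\<close>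

definition avg_fun :: "nat \<Rightarrow> (nat \<Rightarrow> 'a \<Rightarrow> real) \<Rightarrow> 'a \<Rightarrow> real" where
  "avg_fun n f x = (1 / real n) * (\<Sum>j=1..n. f j x)"

definition admissible_summands ::
  "(real^'d) set \<Rightarrow> real \<Rightarrow> real \<Rightarrow> nat \<Rightarrow> (nat \<Rightarrow> real^'d \<Rightarrow> real) \<Rightarrow> bool" where
  "admissible_summands M \<l>f Mf n f \<longleftrightarrow>
     (\<forall>j\<in>{1..n}. (\<forall>x. f j differentiable (at x)) \<and> continuous_on UNIV (gradient (f j))) \<and>
     (\<exists>U. open U \<and> M \<subseteq> U \<and> (\<forall>j\<in>{1..n}. \<l>f-lipschitz_on U (gradient (f j)))) \<and>
     (\<forall>j\<in>{1..n}. \<forall>x\<in>M. norm (gradient (f j) x) \<le> Mf)"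

section \<open>The subproblem and its dual\<close>

definition prox :: "real \<Rightarrow> ('a::real_normed_vector \<Rightarrow> real) \<Rightarrow> 'a \<Rightarrow> 'a" where
  "prox \<alpha> R z = arg_min (\<lambda>y. R y + 1 / (2 * \<alpha>) * (norm (y - z))\<^sup>2) (\<lambda>_. True)"

text \<open>The supremum is taken in \<open>real\<close>, so this is the Fenchel conjugate at those \<open>y\<close> where it is
  finite; for the strongly convex functions it is applied to below, that is everywhere.\<close>

definition fenchel_conjugate :: "('a::real_inner \<Rightarrow> real) \<Rightarrow> 'a \<Rightarrow> real" where
  "fenchel_conjugate F y = (SUP \<eta>. inner y \<eta> - F \<eta>)"

definition step_model ::
  "('a::real_inner \<Rightarrow> real) \<Rightarrow> real \<Rightarrow> 'a \<Rightarrow> 'a \<Rightarrow> 'a \<Rightarrow> real" where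
  "step_model R \<alpha> x m \<eta> = inner m \<eta> + 1 / (2 * \<alpha>) * (norm \<eta>)\<^sup>2 + R (x + \<eta>)"

definition dual_model ::
  "(real^'d \<Rightarrow> real) \<Rightarrow> real \<Rightarrow> (real^'d \<Rightarrow> real^'d^'p) \<Rightarrow> real^'d \<Rightarrow> real^'d \<Rightarrow> real^'p \<Rightarrow> real" where
  "dual_model R \<alpha> B x m lam =
     fenchel_conjugate (step_model R \<alpha> x m) (- (transpose (B x) *v lam))"

definition exact_step ::
  "(real^'d) set \<Rightarrow> (real^'d \<Rightarrow> real) \<Rightarrow> real \<Rightarrow> real^'d \<Rightarrow> real^'d \<Rightarrow> real^'d" where
  "exact_step M R \<alpha> x m = arg_min (step_model R \<alpha> x m) (\<lambda>\<eta>. \<eta> \<in> tangent_space M x)"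

section \<open>The algorithm iRPMVR\<close>

text \<open>All quantities of a run are random sequences on a sample space \<open>'w\<close>. \<open>state_it r k\<close> is the
  estimator state at the moment the batch of step \<open>k\<close> is drawn; its type \<open>'s\<close> is left open because
  the estimator is. Batches are multisets, so that both sampling with and without replacement are
  covered.\<close>

record ('w, 'e, 'q, 's) irpmvr_run =
  batch_it :: "nat \<Rightarrow> 'w \<Rightarrow> nat multiset"
  state_it :: "nat \<Rightarrow> 'w \<Rightarrow> 's"
  gamma_it :: "nat \<Rightarrow> 'w \<Rightarrow> real"
  Delta_it :: "nat \<Rightarrow> 'w \<Rightarrow> real"
  chi_it :: "nat \<Rightarrow> 'w \<Rightarrow> real"
  x_it :: "nat \<Rightarrow> 'w \<Rightarrow> 'e"
  u_it :: "nat \<Rightarrow> 'w \<Rightarrow> 'e"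
  uhat_it :: "nat \<Rightarrow> 'w \<Rightarrow> 'e"
  mbar_it :: "nat \<Rightarrow> 'w \<Rightarrow> 'e"
  m_it :: "nat \<Rightarrow> 'w \<Rightarrow> 'e"
  lambda_it :: "nat \<Rightarrow> 'w \<Rightarrow> 'q"
  w_it :: "nat \<Rightarrow> 'w \<Rightarrow> 'e"
  eta_it :: "nat \<Rightarrow> 'w \<Rightarrow> 'e"

text \<open>\<open>H k\<close> is the history available before the batch of step \<open>k\<close> is drawn; it contains the batches
  of the earlier steps. No batch is drawn at step \<open>0\<close>.\<close>

definition history_adapted ::
  "nat \<Rightarrow> 'w measure \<Rightarrow> (nat \<Rightarrow> 'w measure) \<Rightarrow> 's measure \<Rightarrow> ('w, 'e, 'q, 's) irpmvr_run \<Rightarrow> bool" where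
  "history_adapted n P H S r \<longleftrightarrow>
     prob_space P \<and> filtration (space P) H \<and> (\<forall>k. subalgebra P (H k)) \<and>
     (\<forall>k\<ge>1. batch_it r k \<in> H (Suc k) \<rightarrow>\<^sub>M count_space {b. set_mset b \<subseteq> {1..n}}) \<and>
     (\<forall>k\<ge>1. state_it r k \<in> H k \<rightarrow>\<^sub>M S) \<and>
     (\<forall>k. gamma_it r k \<in> borel_measurable (H k) \<and>
          Delta_it r k \<in> borel_measurable (H k) \<and>
          chi_it r k \<in> borel_measurable (H k))"

definition irpmvr_init ::
  "(real^'d) set \<Rightarrow> (real^'d \<Rightarrow> real) \<Rightarrow> ('w, real^'d, real^'p, 's) irpmvr_run \<Rightarrow> 'w \<Rightarrow> bool" where
  "irpmvr_init M F r \<omega> \<longleftrightarrow>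
     u_it r 0 \<omega> = riemannian_grad M F (x_it r 0 \<omega>) \<and>
     uhat_it r 0 \<omega> = riemannian_grad M F (x_it r 0 \<omega>) \<and>
     mbar_it r 0 \<omega> = riemannian_grad M F (x_it r 0 \<omega>)"

text \<open>\<open>est k\<close> is the (arbitrary) rule that forms the estimator at step \<open>k\<close> from the estimator state
  and the batch.\<close>

definition irpmvr_step ::
  "(real^'d) set \<Rightarrow> (real^'d \<Rightarrow> real^'d \<Rightarrow> real^'d) \<Rightarrow> (real^'d \<Rightarrow> real^'d^'p) \<Rightarrow> (real^'d \<Rightarrow> real) \<Rightarrow>
   real \<Rightarrow> real \<Rightarrow> (nat \<Rightarrow> 's \<Rightarrow> nat multiset \<Rightarrow> real^'d) \<Rightarrow>
   ('w, real^'d, real^'p, 's) irpmvr_run \<Rightarrow> 'w \<Rightarrow> nat \<Rightarrow> bool" where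
  "irpmvr_step M Retr B R \<alpha> Mu est r \<omega> k \<longleftrightarrow>
     (let x = x_it r k \<omega>; m = m_it r k \<omega>; w = w_it r k \<omega>; \<eta> = eta_it r k \<omega>;
          chi = chi_it r k \<omega>; lam = lambda_it r k \<omega>
      in
      (k \<noteq> 0 \<longrightarrow>
         u_it r k \<omega> = est k (state_it r k \<omega>) (batch_it r k \<omega>) \<and>
         u_it r k \<omega> \<in> tangent_space M x \<and>
         uhat_it r k \<omega> = closest_point (cball 0 Mu) (u_it r k \<omega>)) \<and>
      m = chi *\<^sub>R mbar_it r k \<omega> + (1 - chi) *\<^sub>R uhat_it r k \<omega> \<and>
      norm (gradient (dual_model R \<alpha> B x m) lam) \<le> Delta_it r k \<omega> \<and>
      w = prox \<alpha> R (x - \<alpha> *\<^sub>R (m + transpose (B x) *v lam)) - x \<and>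
      \<eta> = closest_point (tangent_space M x) w \<and>
      x_it r (Suc k) \<omega> = Retr x (gamma_it r k \<omega> *\<^sub>R \<eta>) \<and>
      mbar_it r (Suc k) \<omega> = closest_point (tangent_space M (x_it r (Suc k) \<omega>)) m)"

definition irpmvr ::
  "(real^'d) set \<Rightarrow> (real^'d \<Rightarrow> real^'d \<Rightarrow> real^'d) \<Rightarrow> (real^'d \<Rightarrow> real^'d^'p) \<Rightarrow> (real^'d \<Rightarrow> real) \<Rightarrow>
   real \<Rightarrow> real \<Rightarrow> real \<Rightarrow> real \<Rightarrow> real \<Rightarrow> nat \<Rightarrow> (nat \<Rightarrow> real^'d \<Rightarrow> real) \<Rightarrow>
   'w measure \<Rightarrow> (nat \<Rightarrow> 'w measure) \<Rightarrow> 's measure \<Rightarrow> (nat \<Rightarrow> 's \<Rightarrow> nat multiset \<Rightarrow> real^'d) \<Rightarrow>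
   real^'d \<Rightarrow> ('w, real^'d, real^'p, 's) irpmvr_run \<Rightarrow> bool" where
  "irpmvr M Retr B R \<alpha> \<gamma> \<Delta>bar \<chi>bar Mu n f P H S est x0 r \<longleftrightarrow>
     history_adapted n P H S r \<and>
     (\<forall>\<omega>\<in>space P.
        x_it r 0 \<omega> = x0 \<and> irpmvr_init M (avg_fun n f) r \<omega> \<and>
        (\<forall>k. gamma_it r k \<omega> \<in> {\<gamma>..1} \<and> Delta_it r k \<omega> \<in> {0..\<Delta>bar} \<and>
             chi_it r k \<omega> \<in> {0..\<chi>bar} \<and>
             irpmvr_step M Retr B R \<alpha> Mu est r \<omega> k))"

end

theory Submission
  imports Defs
begin

text \<open>The inverse function theorem identifies the tangent space at \<open>x\<close> with the kernel of \<open>B x\<close>; in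
  particular it is a closed subspace. The gradient of the dual model at \<open>lam\<close> is \<open>- B x w\<close>, where \<open>w\<close>
  minimizes the step model tilted by \<open>transpose (B x) *v lam\<close>, so the first two estimates are the
  stopping criterion and the assumption on \<open>C0\<close>. For the other two, let \<open>\<phi>\<close> be the tilted model and
  \<open>d = w - \<eta>\<close>. The tilt vanishes on the tangent space, so strong convexity at both \<open>w\<close> and \<open>\<eta>hat\<close>
  bounds \<open>(norm (\<eta> - \<eta>hat))\<^sup>2 + (norm (w - \<eta>hat))\<^sup>2\<close> by \<open>2 * \<alpha> * (\<phi> \<eta> - \<phi> w)\<close>. By minimality
  \<open>\<phi> w \<le> \<phi> (w + d)\<close>, hence \<open>\<phi> \<eta> - \<phi> w\<close> is at most the second difference
  \<open>\<phi> (w - d) - 2 * \<phi> w + \<phi> (w + d)\<close>, from which all linear terms, and with them the unknown \<open>lam\<close>,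
  cancel.\<close>

section \<open>Tangent spaces of level sets\<close>

text \<open>A local diffeomorphism \<open>\<Phi>\<close> flattens the level set, and the required
  curve is the preimage of the line \<open>t *\<^sub>R v\<close>. Most of the work goes into
  continuity of its velocity, since \<open>tangent_space\<close> asks for C1 curves.\<close>

lemma kernel_subset_tangent_space:
  fixes \<psi> :: "'a::euclidean_space \<Rightarrow> 'b::euclidean_space"
  assumes "open U" "x \<in> U"
    and der: "\<And>y. y \<in> U \<Longrightarrow> (\<psi> has_derivative D y) (at y)"
    and cont: "\<And>u. continuous_on U (\<lambda>y. D y u)"
    and surj: "surj (D x)"
    and \<psi>x: "\<psi> x = 0" and v: "D x v = 0"
    and M: "{y \<in> U. \<psi> y = 0} \<subseteq> M"
  shows "v \<in> tangent_space M x"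
proof -
  have linD: "linear (D y)" if "y \<in> U" for y
    using der[OF that] has_derivative_linear by blast
  obtain A where "linear A" and A: "\<And>z. D x (A z) = z"
    using linear_surjective_right_inverse[OF linD[OF \<open>x \<in> U\<close>] surj] by (metis comp_apply id_apply)
  \<comment> \<open>\<open>\<Phi>\<close> has the identity as differential at \<open>x\<close>, and \<open>D x (\<Phi> y) = \<psi> y\<close>.\<close>
  define \<Phi> where "\<Phi> y = (y - x) - A (D x (y - x)) + A (\<psi> y)" for y
  \<comment> \<open>\<open>E y\<close> is the differential of \<open>\<Phi>\<close> at
    \<open>y\<close>; \<open>E'\<close> is the same map as a point of the normed space of bounded
    linear maps, the form in which the inverse function theorem takes it.\<close>
  define E where "E y u = u - A (D x u) + A (D y u)" for y u
  define E' where "E' y = Blinfun (E y)" for y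
  have blA: "bounded_linear A" and blx: "bounded_linear (D x)"
    using \<open>linear A\<close> linD[OF \<open>x \<in> U\<close>] linear_conv_bounded_linear by blast+
  have blE: "bounded_linear (E y)" if "y \<in> U" for y
    unfolding E_def using linD[OF that] linear_conv_bounded_linear
    by (intro bounded_linear_add bounded_linear_sub bounded_linear_ident
        bounded_linear_compose[OF blA] blx) blast+
  have E': "blinfun_apply (E' y) = E y" if "y \<in> U" for y
    unfolding E'_def by (rule bounded_linear_Blinfun_apply[OF blE[OF that]])
  have D\<Phi>: "(\<Phi> has_derivative blinfun_apply (E' y)) (at y)" if "y \<in> U" for y
    unfolding E'[OF that] \<Phi>_def[abs_def] E_def[abs_def]
    by (auto intro!: derivative_eq_intros bounded_linear.has_derivative[OF blA]
        bounded_linear.has_derivative[OF blx] der[OF that])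
  \<comment> \<open>In finite dimension, continuity in operator norm reduces to continuity on basis
    vectors, which \<open>cont\<close> supplies.\<close>
  have contE: "continuous_on U E'"
  proof (rule continuous_on_blinfun_componentwise)
    fix i :: 'a
    have "continuous_on U (\<lambda>y. E y i)"
      unfolding E_def by (intro continuous_intros bounded_linear.continuous_on[OF blA] cont)
    then show "continuous_on U (\<lambda>y. blinfun_apply (E' y) i)"
      by (rule continuous_on_eq) (simp add: E')
  qed
  have idE: "E' x = id_blinfun"
    by (rule blinfun_eqI) (simp add: E'[OF \<open>x \<in> U\<close>] E_def)
  \<comment> \<open>The radius 1/2 keeps the differentials on \<open>W\<close> uniformly invertible,
    as quantified by \<open>E_lower\<close>.\<close>
  define W where "W = U \<inter> E' -` ball id_blinfun (1/2)"
  have "open W"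
    unfolding W_def using continuous_open_preimage[OF contE \<open>open U\<close>] by simp
  have "x \<in> W" "W \<subseteq> U" using \<open>x \<in> U\<close> by (auto simp: W_def idE)
  obtain U' V g g' where "open U'" "U' \<subseteq> W" "x \<in> U'" "open V" "\<Phi> x \<in> V"
    and hom: "homeomorphism U' V \<Phi> g"
    and g: "\<And>y. y \<in> V \<Longrightarrow> (g has_derivative g' y) (at y)"
    and g': "\<And>y. y \<in> V \<Longrightarrow> g' y = inv (blinfun_apply (E' (g y)))"
    and bij: "\<And>y. y \<in> V \<Longrightarrow> bij (blinfun_apply (E' (g y)))"
  proof (rule inverse_function_theorem[OF \<open>open W\<close>, of \<Phi> E' x id_blinfun])
    show "\<And>y. y \<in> W \<Longrightarrow> (\<Phi> has_derivative blinfun_apply (E' y)) (at y)"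
      using D\<Phi> \<open>W \<subseteq> U\<close> by blast
    show "continuous_on W E'" using contE \<open>W \<subseteq> U\<close> continuous_on_subset by blast
    show "id_blinfun o\<^sub>L E' x = id_blinfun"
      by (rule blinfun_eqI) (simp add: idE)
  qed (use \<open>x \<in> W\<close> in auto)
  have A0: "A 0 = 0" and Dx0: "D x 0 = 0" using blA blx by (simp_all add: linear_simps)
  have \<Phi>x: "\<Phi> x = 0" by (simp add: \<Phi>_def \<psi>x A0 Dx0)
  define c where "c t = g (t *\<^sub>R v)" for t :: real
  define c' where "c' t = g' (t *\<^sub>R v) v" for t :: real
  have "open ((\<lambda>t::real. t *\<^sub>R v) -` V)"
    by (rule open_vimage[OF \<open>open V\<close>]) (intro continuous_intros)
  moreover have "0 \<in> (\<lambda>t::real. t *\<^sub>R v) -` V" using \<open>\<Phi> x \<in> V\<close> \<Phi>x by simp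
  ultimately obtain e where "e > 0" and e: "ball 0 e \<subseteq> (\<lambda>t::real. t *\<^sub>R v) -` V"
    using open_contains_ball by blast
  define J where "J = {-e<..<e}"
  have inV: "t *\<^sub>R v \<in> V" if "t \<in> J" for t
    using e that by (auto simp: J_def subset_iff)
  have cU: "c t \<in> U'" and \<Phi>c: "\<Phi> (c t) = t *\<^sub>R v" if "t \<in> J" for t
    using hom inV[OF that] unfolding c_def homeomorphism_def by auto
  \<comment> \<open>\<open>D x\<close> kills \<open>t *\<^sub>R v\<close>, so \<open>\<psi>\<close>
    vanishes along the curve.\<close>
  have cM: "c t \<in> M" if "t \<in> J" for t
  proof -
    have "D x (\<Phi> (c t)) = \<psi> (c t)"
      unfolding \<Phi>_def using linD[OF \<open>x \<in> U\<close>] by (simp add: linear_add linear_diff A)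
    then have "\<psi> (c t) = 0"
      unfolding \<Phi>c[OF that] using linD[OF \<open>x \<in> U\<close>] v by (simp add: linear_cmul)
    then show ?thesis using M cU[OF that] \<open>U' \<subseteq> W\<close> \<open>W \<subseteq> U\<close> by auto
  qed
  have dc: "(c has_vector_derivative c' t) (at t)" if "t \<in> J" for t
  proof -
    have "((\<lambda>t. t *\<^sub>R v) has_vector_derivative v) (at t)"
      by (auto intro!: derivative_eq_intros simp: has_vector_derivative_def)
    moreover have "(g has_derivative g' (t *\<^sub>R v)) (at (t *\<^sub>R v) within range (\<lambda>t. t *\<^sub>R v))"
      using g[OF inV[OF that]] has_derivative_at_withinI by blast
    ultimately show ?thesis
      unfolding c_def[abs_def] c'_def
      using vector_derivative_diff_chain_within[of "\<lambda>t. t *\<^sub>R v" v t UNIV g] by (simp add: o_def)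
  qed
  have Ec: "E' (c t) (c' t) = v" if "t \<in> J" for t
    unfolding c'_def g'[OF inV[OF that]] c_def
    using bij[OF inV[OF that]] by (simp add: bij_is_surj surj_f_inv_f)
  \<comment> \<open>An operator within 1/2 of the identity shrinks no vector by more than a factor
    2.\<close>
  have E_lower: "norm u \<le> 2 * norm (E' (c t) u)" if "t \<in> J" for t u
  proof -
    have "dist id_blinfun (E' (c t)) < 1/2"
      using cU[OF that] \<open>U' \<subseteq> W\<close> by (auto simp: W_def)
    moreover have "norm ((id_blinfun - E' (c t)) u) \<le> norm (id_blinfun - E' (c t)) * norm u"
      by (rule norm_blinfun)
    ultimately have "norm (u - E' (c t) u) \<le> 1/2 * norm u"
      unfolding dist_norm
      by (smt (verit) blinfun.diff_left blinfun_apply_id_blinfun mult_right_mono norm_ge_zero)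
    then show ?thesis using norm_triangle_ineq2[of u "E' (c t) u"] by linarith
  qed
  have contc: "continuous_on J c"
    using dc by (meson continuous_at_imp_continuous_on has_vector_derivative_continuous)
  have contEc: "continuous_on J (\<lambda>t. E' (c t))"
    by (rule continuous_on_compose2[OF contE contc]) (use cU \<open>U' \<subseteq> W\<close> \<open>W \<subseteq> U\<close> in auto)
  \<comment> \<open>No continuity of operator inversion is invoked: \<open>E' (c s)\<close> maps
    \<open>c' s - c' t\<close> to \<open>v - E' (c s) (c' t)\<close>, which tends to 0, and
    \<open>E_lower\<close> carries this back to \<open>c' s - c' t\<close>.\<close>
  have "continuous_on J c'"
    unfolding continuous_on_def
  proof
    fix t assume "t \<in> J"
    have "((\<lambda>s. E' (c s) (c' t)) \<longlongrightarrow> E' (c t) (c' t)) (at t within J)"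
      using contEc \<open>t \<in> J\<close> unfolding continuous_on_def by (intro tendsto_intros) blast
    then have "((\<lambda>s. E' (c s) (c' t) - v) \<longlongrightarrow> 0) (at t within J)"
      using Ec[OF \<open>t \<in> J\<close>] LIM_zero by fastforce
    then have lim: "((\<lambda>s. 2 * norm (E' (c s) (c' t) - v)) \<longlongrightarrow> 0) (at t within J)"
      using tendsto_mult_right_zero tendsto_norm_zero by blast
    have "norm (c' s - c' t) \<le> 2 * norm (E' (c s) (c' t) - v)" if "s \<in> J" for s
      using E_lower[OF that, of "c' s - c' t"] Ec[OF that]
      by (simp add: blinfun.diff_right norm_minus_commute)
    then have "\<forall>\<^sub>F s in at t within J. norm (c' s - c' t) \<le> 2 * norm (E' (c s) (c' t) - v)"
      unfolding eventually_at_filter by (auto intro: always_eventually)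
    then have "((\<lambda>s. c' s - c' t) \<longlongrightarrow> 0) (at t within J)"
      by (rule Lim_null_comparison) (rule lim)
    then show "(c' \<longlongrightarrow> c' t) (at t within J)" using LIM_zero_cancel by blast
  qed
  then have "c C1_differentiable_on J"
    using dc unfolding C1_differentiable_on_def by blast
  moreover have "0 \<in> J" using \<open>e > 0\<close> by (simp add: J_def)
  moreover have "c 0 = x"
    using hom \<open>x \<in> U'\<close> \<Phi>x unfolding c_def homeomorphism_def by fastforce
  moreover have "c' 0 = v"
    using Ec[OF \<open>0 \<in> J\<close>] unfolding \<open>c 0 = x\<close> idE by simp
  ultimately show ?thesis
    unfolding tangent_space_def using dc[of 0] \<open>e > 0\<close> cM unfolding J_def by blast
qed

text \<open>By continuity a curve in \<open>M\<close> through \<open>x\<close> stays in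
  \<open>U\<close> for small times, so \<open>\<psi>\<close> is constantly 0 along it there and the
  chain rule applies.\<close>

lemma tangent_space_subset_kernel:
  fixes \<psi> :: "'a::real_normed_vector \<Rightarrow> 'b::real_normed_vector"
  assumes "open U" "x \<in> U" and der: "(\<psi> has_derivative D) (at x)"
    and M: "M \<inter> U \<subseteq> {y. \<psi> y = 0}" and v: "v \<in> tangent_space M x"
  shows "D v = 0"
proof -
  obtain c e where "e > 0" and cM: "c ` {-e<..<e} \<subseteq> M" and "c 0 = x"
    and dc: "(c has_vector_derivative v) (at 0)"
    using v unfolding tangent_space_def by blast
  have "((\<lambda>t. \<psi> (c t)) has_vector_derivative D v) (at 0)"
    using vector_derivative_diff_chain_within[of c v 0 UNIV \<psi> D] dc
      has_derivative_at_withinI[OF der] \<open>c 0 = x\<close> by (simp add: o_def)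
  moreover have "((\<lambda>t. \<psi> (c t)) has_vector_derivative 0) (at 0)"
  proof -
    have "isCont c 0" using dc has_vector_derivative_continuous by blast
    then have "\<forall>\<^sub>F t in nhds 0. c t \<in> U"
      using \<open>open U\<close> \<open>x \<in> U\<close> \<open>c 0 = x\<close> continuous_at_open[of 0 c]
      unfolding eventually_nhds by blast
    moreover have "\<forall>\<^sub>F t in nhds 0. t \<in> {-e<..<e}"
      using \<open>e > 0\<close> by (intro eventually_nhds_in_open) auto
    ultimately have "\<forall>\<^sub>F t in nhds 0. \<psi> (c t) = 0"
      by eventually_elim (use cM M in blast)
    then obtain S where "open S" "0 \<in> S" "\<And>t. t \<in> S \<Longrightarrow> \<psi> (c t) = 0"
      unfolding eventually_nhds by blast
    then show ?thesis
      by (intro has_vector_derivative_transform_within_open[OF has_vector_derivative_const]) auto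
  qed
  ultimately show ?thesis by (rule vector_derivative_unique_at)
qed

lemma tangent_space_eq_kernel:
  fixes \<psi> :: "real^'d \<Rightarrow> real^'p"
  assumes ldf: "local_defining_function M U \<psi>" and "x \<in> U" "x \<in> M"
  shows "tangent_space M x = {v. jacobian \<psi> (at x) *v v = 0}"
proof -
  have "open U" and sm: "smooth_on U \<psi>" and MU: "M \<inter> U = {y \<in> U. \<psi> y = 0}"
    and rk: "rank (jacobian \<psi> (at x)) = CARD('p)"
    using ldf \<open>x \<in> U\<close> \<open>x \<in> M\<close> unfolding local_defining_function_def by auto
  have "Ck_on (Suc 0) U \<psi>" using sm unfolding smooth_on_def by blast
  then have diff: "\<And>y. y \<in> U \<Longrightarrow> \<psi> differentiable (at y)"
    and cont: "\<And>u. continuous_on U (\<lambda>y. frechet_derivative \<psi> (at y) u)" by auto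
  have der: "(\<psi> has_derivative (*v) (jacobian \<psi> (at y))) (at y)" if "y \<in> U" for y
    using diff[OF that] jacobian_works by blast
  have "continuous_on U (\<lambda>y. jacobian \<psi> (at y) *v u)" for u
    using cont[of u] der frechet_derivative_at
    by (metis (no_types, lifting) continuous_on_cong)
  moreover have "surj ((*v) (jacobian \<psi> (at x)))" using rk full_rank_surjective by blast
  ultimately have "v \<in> tangent_space M x" if "jacobian \<psi> (at x) *v v = 0" for v
    using kernel_subset_tangent_space[OF \<open>open U\<close> \<open>x \<in> U\<close> der, of v M] that MU \<open>x \<in> U\<close> \<open>x \<in> M\<close>
    by blast
  moreover have "jacobian \<psi> (at x) *v v = 0" if "v \<in> tangent_space M x" for v
    using tangent_space_subset_kernel[OF \<open>open U\<close> \<open>x \<in> U\<close> der[OF \<open>x \<in> U\<close>] _ that] MU by blast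
  ultimately show ?thesis by blast
qed

lemma defining_jacobian_kernel:
  fixes \<psi> :: "'i \<Rightarrow> real^'d \<Rightarrow> real^'p"
  assumes "defining_cover M I V U \<psi> \<l>" "x \<in> M"
  shows "tangent_space M x = {v. defining_jacobian \<psi> \<l> x *v v = 0}"
proof -
  have "\<l> x \<in> I" "x \<in> V (\<l> x)" "closure (V (\<l> x)) \<subseteq> U (\<l> x)"
    "local_defining_function M (U (\<l> x)) (\<psi> (\<l> x))"
    using assms unfolding defining_cover_def by blast+
  then show ?thesis
    unfolding defining_jacobian_def using tangent_space_eq_kernel \<open>x \<in> M\<close> closure_subset by blast
qed

section \<open>The step model\<close>

text \<open>\<open>arg_min\<close> is a choice operator, so exhibiting any minimizer makes its value
  one; \<open>prox\<close> and \<open>exact_step\<close> are accessed this way.\<close>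

lemma is_arg_min_arg_min: "is_arg_min f P x \<Longrightarrow> is_arg_min f P (arg_min f P)"
  unfolding arg_min_def by (rule someI)

text \<open>A linear tilt is absorbed into the slot of \<open>m\<close>, so the model with the
  multiplier term is again a step model.\<close>

lemma step_model_add: "step_model R \<alpha> x (m + b) \<eta> = step_model R \<alpha> x m \<eta> + inner b \<eta>"
  by (simp add: step_model_def inner_add_left)

lemma step_model_attains_min:
  fixes S :: "'a::euclidean_space set"
  assumes lip: "\<l>R-lipschitz_on UNIV R" and "\<alpha> > 0" and "closed S" "0 \<in> S"
  shows "\<exists>\<eta>. is_arg_min (step_model R \<alpha> x m) (\<lambda>\<eta>. \<eta> \<in> S) \<eta>"
proof -
  \<comment> \<open>\<open>L\<close> bounds the slope of everything but the quadratic term, so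
    beyond radius \<open>2 * \<alpha> * L\<close> the model is no smaller than at \<open>0\<close>,
    itself a point of the compact set \<open>K\<close>.\<close>
  define L where "L = norm m + \<l>R"
  have "L \<ge> 0" using lipschitz_on_nonneg[OF lip] by (simp add: L_def)
  define K where "K = S \<inter> cball 0 (2 * \<alpha> * L)"
  have "compact K" unfolding K_def using \<open>closed S\<close> by (simp add: closed_Int_compact)
  moreover have "0 \<in> K" unfolding K_def using \<open>0 \<in> S\<close> \<open>L \<ge> 0\<close> \<open>\<alpha> > 0\<close> by simp
  moreover have "continuous_on K (step_model R \<alpha> x m)"
  proof -
    have "continuous_on UNIV R" using lip lipschitz_on_continuous_on by blast
    then have "continuous_on K (\<lambda>\<eta>. R (x + \<eta>))"
      by (rule continuous_on_compose2) (auto intro!: continuous_intros)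
    then show ?thesis unfolding step_model_def[abs_def] by (intro continuous_intros)
  qed
  ultimately obtain \<eta> where "\<eta> \<in> K"
    and min: "\<And>z. z \<in> K \<Longrightarrow> step_model R \<alpha> x m \<eta> \<le> step_model R \<alpha> x m z"
    using continuous_attains_inf[of K] by blast
  have "step_model R \<alpha> x m \<eta> \<le> step_model R \<alpha> x m z" if "z \<in> S" for z
  proof (cases "z \<in> K")
    case False
    then have "norm z > 2 * \<alpha> * L" using that by (simp add: K_def)
    then have "2 * \<alpha> * L * norm z \<le> norm z * norm z" by (intro mult_right_mono) auto
    then have "L * norm z \<le> 1 / (2 * \<alpha>) * (norm z)\<^sup>2"
      using \<open>\<alpha> > 0\<close> by (simp add: field_simps power2_eq_square)
    moreover have "\<bar>R (x + z) - R x\<bar> \<le> \<l>R * norm z"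
      using lipschitz_onD[OF lip, of "x + z" x] by (simp add: dist_norm)
    moreover have "\<bar>inner m z\<bar> \<le> norm m * norm z" by (rule Cauchy_Schwarz_ineq2)
    ultimately have "step_model R \<alpha> x m 0 \<le> step_model R \<alpha> x m z"
      by (simp add: step_model_def L_def distrib_right)
    then show ?thesis using min[OF \<open>0 \<in> K\<close>] by linarith
  qed (rule min)
  then show ?thesis using \<open>\<eta> \<in> K\<close> by (auto simp: is_arg_min_linorder K_def)
qed

text \<open>The model is strongly convex with modulus \<open>1 / \<alpha>\<close>. Comparing the
  minimizer with points on the segment towards \<open>z\<close> gives the growth without
  subgradients.\<close>

lemma step_model_quadratic_growth:
  fixes S :: "'a::real_inner set"
  assumes cvx: "convex_on UNIV R" and "\<alpha> > 0" and "convex S" and "z \<in> S"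
    and min: "is_arg_min (step_model R \<alpha> x m) (\<lambda>\<eta>. \<eta> \<in> S) \<eta>"
  shows "step_model R \<alpha> x m \<eta> + 1 / (2 * \<alpha>) * (norm (z - \<eta>))\<^sup>2 \<le> step_model R \<alpha> x m z"
proof -
  define F where "F = step_model R \<alpha> x m"
  define q where "q = 1 / (2 * \<alpha>) * (norm (z - \<eta>))\<^sup>2"
  have "\<eta> \<in> S" and le: "\<And>y. y \<in> S \<Longrightarrow> F \<eta> \<le> F y"
    using min by (auto simp: is_arg_min_linorder F_def)
  have *: "F \<eta> + (1 - t) * q \<le> F z" if "0 < t" "t < 1" for t :: real
  proof -
    define y where "y = (1 - t) *\<^sub>R \<eta> + t *\<^sub>R z"
    have "y \<in> S"
      unfolding y_def using \<open>convex S\<close> \<open>\<eta> \<in> S\<close> \<open>z \<in> S\<close> that by (simp add: convex_alt)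
    have "x + y = (1 - t) *\<^sub>R (x + \<eta>) + t *\<^sub>R (x + z)"
      by (simp add: y_def algebra_simps)
    then have R: "R (x + y) \<le> (1 - t) * R (x + \<eta>) + t * R (x + z)"
      using convex_onD[OF cvx, of t "x + \<eta>" "x + z"] that by simp
    \<comment> \<open>The last term of this identity is the source of the gain
      \<open>q\<close>.\<close>
    have sq: "(norm y)\<^sup>2 = (1 - t) * (norm \<eta>)\<^sup>2 + t * (norm z)\<^sup>2 - t * (1 - t) * (norm (z - \<eta>))\<^sup>2"
      unfolding y_def power2_norm_eq_inner
      by (simp add: inner_simps inner_commute algebra_simps power2_eq_square)
    have distr: "p * ((1 - t) * a + t * c - t * (1 - t) * d)
        = (1 - t) * (p * a) + t * (p * c) - t * (1 - t) * (p * d)" for p a c d :: real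
      by (simp add: algebra_simps)
    have "1 / (2 * \<alpha>) * (norm y)\<^sup>2
        = (1 - t) * (1 / (2 * \<alpha>) * (norm \<eta>)\<^sup>2) + t * (1 / (2 * \<alpha>) * (norm z)\<^sup>2) - t * (1 - t) * q"
      unfolding sq q_def by (rule distr)
    moreover have "inner m y = (1 - t) * inner m \<eta> + t * inner m z"
      by (simp add: y_def inner_simps)
    ultimately have "F y \<le> (1 - t) * F \<eta> + t * F z - t * (1 - t) * q"
      using R unfolding F_def step_model_def by (simp add: algebra_simps)
    with le[OF \<open>y \<in> S\<close>] have "t * (F \<eta> + (1 - t) * q) \<le> t * F z"
      by (simp add: algebra_simps)
    then show ?thesis using that by simp
  qed
  \<comment> \<open>Dividing by \<open>t\<close> excludes \<open>t = 0\<close>, so the full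
    \<open>q\<close> is reached only in the limit from the right.\<close>
  have "((\<lambda>t. F \<eta> + (1 - t) * q) \<longlongrightarrow> F \<eta> + (1 - 0) * q) (at_right 0)"
    by (intro tendsto_intros)
  moreover have "\<forall>\<^sub>F t in at_right 0. F \<eta> + (1 - t) * q \<le> F z"
    using eventually_at_right_real[OF zero_less_one] by (rule eventually_mono) (auto intro!: *)
  ultimately have "F \<eta> + (1 - 0) * q \<le> F z"
    by (intro tendsto_upperbound) auto
  then show ?thesis by (simp add: F_def q_def)
qed

text \<open>Completing the square: after a shift by \<open>x\<close>, the objective of
  \<open>prox\<close> and the step model differ by the constant
  \<open>\<alpha> / 2 * (norm m)\<^sup>2\<close>.\<close>

lemma prox_step_is_arg_min:
  fixes R :: "'a::euclidean_space \<Rightarrow> real"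
  assumes "\<l>R-lipschitz_on UNIV R" and "\<alpha> > 0"
  shows "is_arg_min (step_model R \<alpha> x m) (\<lambda>\<eta>. \<eta> \<in> UNIV) (prox \<alpha> R (x - \<alpha> *\<^sub>R m) - x)"
proof -
  define p where "p y = R y + 1 / (2 * \<alpha>) * (norm (y - (x - \<alpha> *\<^sub>R m)))\<^sup>2" for y
  have p: "p y = step_model R \<alpha> x m (y - x) + \<alpha> / 2 * (norm m)\<^sup>2" for y
  proof -
    have "(norm ((y - x) + \<alpha> *\<^sub>R m))\<^sup>2
        = (norm (y - x))\<^sup>2 + 2 * \<alpha> * inner m (y - x) + \<alpha>\<^sup>2 * (norm m)\<^sup>2"
      unfolding power2_norm_eq_inner
      by (simp only: inner_add_left inner_add_right inner_scaleR_left inner_scaleR_right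
          inner_commute[of "y - x" m]) (simp add: algebra_simps power2_eq_square)
    moreover have "y - (x - \<alpha> *\<^sub>R m) = (y - x) + \<alpha> *\<^sub>R m" by simp
    ultimately show ?thesis
      unfolding p_def step_model_def using \<open>\<alpha> > 0\<close> by (simp add: field_simps power2_eq_square)
  qed
  obtain \<eta> where "is_arg_min (step_model R \<alpha> x m) (\<lambda>\<eta>. \<eta> \<in> UNIV) \<eta>"
    using step_model_attains_min[OF assms] by blast
  then have "is_arg_min p (\<lambda>_. True) (x + \<eta>)" by (simp add: is_arg_min_linorder p)
  then have "is_arg_min p (\<lambda>_. True) (prox \<alpha> R (x - \<alpha> *\<^sub>R m))"
    unfolding prox_def p_def[abs_def] by (rule is_arg_min_arg_min)
  then have le: "step_model R \<alpha> x m (prox \<alpha> R (x - \<alpha> *\<^sub>R m) - x) \<le> step_model R \<alpha> x m (y - x)" for y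
    by (simp add: is_arg_min_linorder p)
  show ?thesis
    using le[of "x + z" for z] by (simp add: is_arg_min_linorder)
qed

section \<open>The gradient of the dual model\<close>

lemma has_derivative_of_quadratic_error:
  fixes f :: "'a::real_normed_vector \<Rightarrow> 'b::real_normed_vector"
  assumes "bounded_linear D" and err: "\<And>y. norm (f y - f x - D (y - x)) \<le> K * (norm (y - x))\<^sup>2"
  shows "(f has_derivative D) (at x)"
proof -
  have "norm ((f y - f x - D (y - x)) /\<^sub>R norm (y - x)) \<le> K * norm (y - x)" for y
  proof (cases "y = x")
    case False
    then have "norm (f y - f x - D (y - x)) / norm (y - x) \<le> K * norm (y - x)"
      using err[of y] by (simp add: pos_divide_le_eq power2_eq_square mult.assoc)
    then show ?thesis by (simp add: divide_inverse mult.commute)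
  qed simp
  then have bound: "\<forall>\<^sub>F y in at x. norm ((f y - f x - D (y - x)) /\<^sub>R norm (y - x)) \<le> K * norm (y - x)"
    by simp
  have "((\<lambda>y. K * norm (y - x)) \<longlongrightarrow> K * norm (x - x)) (at x)"
    by (intro tendsto_intros)
  then have "((\<lambda>y. K * norm (y - x)) \<longlongrightarrow> 0) (at x)" by simp
  with bound have "((\<lambda>y. (f y - f x - D (y - x)) /\<^sub>R norm (y - x)) \<longlongrightarrow> 0) (at x)"
    by (rule Lim_null_comparison)
  then show ?thesis
    using \<open>bounded_linear D\<close> unfolding has_derivative_at_within by blast
qed

lemma gradient_eqI:
  assumes "GDERIV h x :> D"
  shows "gradient h x = D"
  unfolding gradient_def
proof (rule the_equality)
  show "GDERIV h x :> D" by (rule assms)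
next
  fix D' assume "GDERIV h x :> D'"
  then have "(\<lambda>v. inner v D') = (\<lambda>v. inner v D)"
    using assms unfolding gderiv_def by (rule has_derivative_unique)
  then show "D' = D" by (metis inner_commute vector_eq_ldot)
qed

text \<open>The function under the supremum is the negated tilted model, so the real-valued
  \<open>SUP\<close> is an attained maximum.\<close>

lemma fenchel_conjugate_step_model:
  fixes R :: "'a::euclidean_space \<Rightarrow> real"
  assumes "is_arg_min (step_model R \<alpha> x (m + b)) (\<lambda>\<eta>. \<eta> \<in> UNIV) w"
  shows "fenchel_conjugate (step_model R \<alpha> x m) (- b) = - step_model R \<alpha> x (m + b) w"
proof -
  have "inner (- b) \<eta> - step_model R \<alpha> x m \<eta> = - step_model R \<alpha> x (m + b) \<eta>" for \<eta>
    by (simp add: step_model_add)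
  then show ?thesis
    unfolding fenchel_conjugate_def using assms
    by (intro cSup_eq_maximum) (auto simp: is_arg_min_linorder)
qed

text \<open>The envelope theorem: comparing the minimizers \<open>w\<close> and \<open>w'\<close> of two tilted models with each other
  bounds the first-order error of the conjugate from both sides.\<close>

lemma fenchel_conjugate_step_model_error:
  fixes R :: "'a::euclidean_space \<Rightarrow> real"
  assumes cvx: "convex_on UNIV R" and lip: "\<l>R-lipschitz_on UNIV R" and "\<alpha> > 0"
    and w: "is_arg_min (step_model R \<alpha> x (m + b)) (\<lambda>\<eta>. \<eta> \<in> UNIV) w"
  shows "\<bar>fenchel_conjugate (step_model R \<alpha> x m) (- b')
     - fenchel_conjugate (step_model R \<alpha> x m) (- b) + inner (b' - b) w\<bar> \<le> \<alpha> / 2 * (norm (b' - b))\<^sup>2"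
proof -
  obtain w' where w': "is_arg_min (step_model R \<alpha> x (m + b')) (\<lambda>\<eta>. \<eta> \<in> UNIV) w'"
    using step_model_attains_min[OF lip \<open>\<alpha> > 0\<close>, of UNIV] by auto
  define \<phi> where "\<phi> = step_model R \<alpha> x (m + b)"
  have \<phi>': "step_model R \<alpha> x (m + b') z = \<phi> z + inner (b' - b) z" for z
    by (simp add: \<phi>_def step_model_add inner_diff_left)
  \<comment> \<open>Minimality of \<open>w'\<close> alone makes the first-order error
    nonnegative.\<close>
  have lower: "\<phi> w' + inner (b' - b) w' \<le> \<phi> w + inner (b' - b) w"
    using w' by (simp add: is_arg_min_linorder \<phi>')
  have "\<phi> w + 1 / (2 * \<alpha>) * (norm (w' - w))\<^sup>2 \<le> \<phi> w'"
    unfolding \<phi>_def by (rule step_model_quadratic_growth[OF cvx \<open>\<alpha> > 0\<close> _ _ w]) auto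
  \<comment> \<open>Young's inequality, weighted so that its first term is exactly the quadratic
    growth just obtained.\<close>
  moreover have "- inner (b' - b) (w' - w)
      \<le> 1 / (2 * \<alpha>) * (norm (w' - w))\<^sup>2 + \<alpha> / 2 * (norm (b' - b))\<^sup>2"
  proof -
    have "0 \<le> (norm ((w' - w) + \<alpha> *\<^sub>R (b' - b)))\<^sup>2 / (2 * \<alpha>)"
      using \<open>\<alpha> > 0\<close> by simp
    also have "(norm ((w' - w) + \<alpha> *\<^sub>R (b' - b)))\<^sup>2
        = (norm (w' - w))\<^sup>2 + 2 * \<alpha> * inner (b' - b) (w' - w) + \<alpha>\<^sup>2 * (norm (b' - b))\<^sup>2"
      unfolding power2_norm_eq_inner
      by (simp only: inner_add_left inner_add_right inner_scaleR_left inner_scaleR_right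
          inner_commute[of "w' - w" "b' - b"]) (simp add: algebra_simps power2_eq_square)
    finally show ?thesis using \<open>\<alpha> > 0\<close> by (simp add: field_simps power2_eq_square)
  qed
  moreover have "fenchel_conjugate (step_model R \<alpha> x m) (- b') = - (\<phi> w' + inner (b' - b) w')"
    unfolding fenchel_conjugate_step_model[OF w'] \<phi>' ..
  moreover have "fenchel_conjugate (step_model R \<alpha> x m) (- b) = - \<phi> w"
    unfolding fenchel_conjugate_step_model[OF w] \<phi>_def ..
  ultimately show ?thesis using lower by (simp add: inner_diff_right abs_le_iff)
qed

lemma gradient_dual_model:
  fixes B :: "real^'d \<Rightarrow> real^'d^'p"
  assumes cvx: "convex_on UNIV R" and lip: "\<l>R-lipschitz_on UNIV R" and "\<alpha> > 0"
    and w: "is_arg_min (step_model R \<alpha> x (m + transpose (B x) *v lam)) (\<lambda>\<eta>. \<eta> \<in> UNIV) w"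
  shows "gradient (dual_model R \<alpha> B x m) lam = - (B x *v w)"
proof -
  obtain K where K: "\<And>h. norm (transpose (B x) *v h) \<le> norm h * K"
    using bounded_linear.bounded[of "(*v) (transpose (B x))"] matrix_vector_mul_bounded_linear
    by blast
  have err: "norm (dual_model R \<alpha> B x m l - dual_model R \<alpha> B x m lam - inner (l - lam) (- (B x *v w)))
      \<le> \<alpha> / 2 * K\<^sup>2 * (norm (l - lam))\<^sup>2" for l
  proof -
    have "norm (dual_model R \<alpha> B x m l - dual_model R \<alpha> B x m lam - inner (l - lam) (- (B x *v w)))
        \<le> \<alpha> / 2 * (norm (transpose (B x) *v (l - lam)))\<^sup>2"
    proof -
      have "inner (transpose (B x) *v l - transpose (B x) *v lam) w = inner (l - lam) (B x *v w)"
        by (metis dot_lmul_matrix matrix_vector_mult_diff_distrib transpose_matrix_vector)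
      then show ?thesis
        using fenchel_conjugate_step_model_error[OF cvx lip \<open>\<alpha> > 0\<close> w, of "transpose (B x) *v l"]
        by (simp add: dual_model_def matrix_vector_mult_diff_distrib)
    qed
    also have "\<dots> \<le> \<alpha> / 2 * (norm (l - lam) * K)\<^sup>2"
      using \<open>\<alpha> > 0\<close> by (intro mult_left_mono power_mono K) auto
    finally show ?thesis by (simp add: power_mult_distrib mult_ac)
  qed
  show ?thesis
    by (rule gradient_eqI, unfold gderiv_def, rule has_derivative_of_quadratic_error[OF _ err])
      (rule bounded_linear_inner_left)
qed

section \<open>Inexact steps\<close>

text \<open>The parallelogram law handles the quadratic part. The nonsmooth \<open>R\<close>
  contributes a term linear in \<open>norm d\<close>, whence the square root of
  \<open>\<Delta>\<close> in the final bounds.\<close>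

lemma step_model_second_difference:
  fixes R :: "'a::real_inner \<Rightarrow> real"
  assumes lip: "\<l>R-lipschitz_on UNIV R"
  shows "step_model R \<alpha> x m (w - d) + step_model R \<alpha> x m (w + d) - 2 * step_model R \<alpha> x m w
    \<le> 2 * (1 / (2 * \<alpha>)) * (norm d)\<^sup>2 + 2 * \<l>R * norm d"
proof -
  define q where "q = 1 / (2 * \<alpha>)"
  have "R (x + (w - d)) \<le> R (x + w) + \<l>R * norm d" "R (x + (w + d)) \<le> R (x + w) + \<l>R * norm d"
    using lipschitz_onD[OF lip, of "x + (w - d)" "x + w"] lipschitz_onD[OF lip, of "x + (w + d)" "x + w"]
    by (auto simp: dist_norm abs_le_iff)
  moreover have "(norm (w - d))\<^sup>2 = 2 * (norm w)\<^sup>2 + 2 * (norm d)\<^sup>2 - (norm (w + d))\<^sup>2"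
    unfolding power2_norm_eq_inner by (simp add: inner_simps inner_commute)
  then have "q * (norm (w - d))\<^sup>2
      = 2 * (q * (norm w)\<^sup>2) + 2 * q * (norm d)\<^sup>2 - q * (norm (w + d))\<^sup>2"
    by (simp only:) (simp add: algebra_simps)
  ultimately show ?thesis
    unfolding step_model_def inner_add_right inner_diff_right q_def[symmetric]
    by (simp add: algebra_simps)
qed

text \<open>\<open>b\<close> stands for the multiplier term, over whose size there is no control;
  the bound is free of it. Any \<open>\<eta>\<close> in \<open>T\<close> is allowed, so the
  projection enters only through \<open>norm (w - \<eta>)\<close>.\<close>

lemma inexact_step_error:
  fixes T :: "'a::real_inner set"
  assumes cvx: "convex_on UNIV R" and lip: "\<l>R-lipschitz_on UNIV R" and "\<alpha> > 0"
    and "convex T" and "\<eta> \<in> T" and b: "\<And>z. z \<in> T \<Longrightarrow> inner b z = 0"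
    and w: "is_arg_min (step_model R \<alpha> x (m + b)) (\<lambda>\<eta>. \<eta> \<in> UNIV) w"
    and h: "is_arg_min (step_model R \<alpha> x m) (\<lambda>\<eta>. \<eta> \<in> T) h"
  shows "(norm (\<eta> - h))\<^sup>2 + (norm (w - h))\<^sup>2 \<le> 2 * (norm (w - \<eta>))\<^sup>2 + 4 * \<alpha> * \<l>R * norm (w - \<eta>)"
proof -
  define \<phi> where "\<phi> = step_model R \<alpha> x (m + b)"
  define q where "q = 1 / (2 * \<alpha>)"
  have "h \<in> T" using h by (simp add: is_arg_min_linorder)
  have \<phi>T: "step_model R \<alpha> x m z = \<phi> z" if "z \<in> T" for z
    using b[OF that] by (simp add: \<phi>_def step_model_add)
  have "\<phi> h + q * (norm (\<eta> - h))\<^sup>2 \<le> \<phi> \<eta>"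
    using step_model_quadratic_growth[OF cvx \<open>\<alpha> > 0\<close> \<open>convex T\<close> \<open>\<eta> \<in> T\<close> h]
    by (simp add: \<phi>T \<open>\<eta> \<in> T\<close> \<open>h \<in> T\<close> q_def)
  moreover have "\<phi> w + q * (norm (h - w))\<^sup>2 \<le> \<phi> h"
    unfolding \<phi>_def q_def by (rule step_model_quadratic_growth[OF cvx \<open>\<alpha> > 0\<close> _ _ w]) auto
  \<comment> \<open>\<open>w + (w - \<eta>)\<close> is the reflection of \<open>\<eta>\<close> in
    \<open>w\<close>; minimality there supplies the missing third point of the second
    difference.\<close>
  moreover have "\<phi> w \<le> \<phi> (w + (w - \<eta>))"
    using w by (simp add: is_arg_min_linorder \<phi>_def)
  moreover have "\<phi> \<eta> + \<phi> (w + (w - \<eta>)) - 2 * \<phi> w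
      \<le> 2 * q * (norm (w - \<eta>))\<^sup>2 + 2 * \<l>R * norm (w - \<eta>)"
    using step_model_second_difference[OF lip, of \<alpha> x "m + b" w "w - \<eta>"]
    by (simp add: \<phi>_def q_def)
  ultimately have "q * (norm (\<eta> - h))\<^sup>2 + q * (norm (w - h))\<^sup>2
      \<le> 2 * q * (norm (w - \<eta>))\<^sup>2 + 2 * \<l>R * norm (w - \<eta>)"
    by (simp add: norm_minus_commute)
  then have "2 * \<alpha> * (q * (norm (\<eta> - h))\<^sup>2 + q * (norm (w - h))\<^sup>2)
      \<le> 2 * \<alpha> * (2 * q * (norm (w - \<eta>))\<^sup>2 + 2 * \<l>R * norm (w - \<eta>))"
    using \<open>\<alpha> > 0\<close> by (intro mult_left_mono) auto
  then show ?thesis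
    using \<open>\<alpha> > 0\<close> by (simp add: q_def distrib_left mult_ac)
qed

theorem lemma3p1:
  fixes M :: "(real^'d) set"
    and I :: "'i set"
    and V U :: "'i \<Rightarrow> (real^'d) set"
    and \<psi> :: "'i \<Rightarrow> real^'d \<Rightarrow> real^'p"
    and \<l> :: "real^'d \<Rightarrow> 'i"
    and B :: "real^'d \<Rightarrow> real^'d^'p"
    and Retr :: "real^'d \<Rightarrow> real^'d \<Rightarrow> real^'d"
    and R :: "real^'d \<Rightarrow> real"
    and C0 \<l>R \<l>f Mf cf Mu \<alpha>bar \<gamma> \<Delta>bar \<chi>bar :: real
  assumes "compact M"
    and "embedded_submanifold TYPE('p) M"
    and "defining_cover M I V U \<psi> \<l>"
    and "B = defining_jacobian \<psi> \<l>"
    and "C0 > 0"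
    and "\<And>x v. x \<in> M \<Longrightarrow> infdist v (tangent_space M x) \<le> C0 * norm (B x *v v)"
    and "manifold_retraction M Retr"
    and "convex_on UNIV R"
    and "\<l>R-lipschitz_on UNIV R"
    and "Mf > 0"
    and "cf \<ge> 1"
    and "Mu = cf * Mf"
    and "0 < \<gamma>" and "\<gamma> \<le> 1"
    and "\<Delta>bar \<ge> 0"
    and "0 \<le> \<chi>bar" and "\<chi>bar < 1"
  shows "\<exists>C1>0. \<exists>C2>0.
    \<forall>(n::nat) f \<alpha> (P :: 'w measure) H (S :: 's measure) est x0 r.
      n \<ge> 1 \<longrightarrow> admissible_summands M \<l>f Mf n f \<longrightarrow> 0 < \<alpha> \<longrightarrow> \<alpha> \<le> \<alpha>bar \<longrightarrow> x0 \<in> M \<longrightarrow>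
      irpmvr M Retr B R \<alpha> \<gamma> \<Delta>bar \<chi>bar Mu n f P H S est x0 r \<longrightarrow>
      (\<forall>\<omega>\<in>space P. \<forall>k.
         let x = x_it r k \<omega>; w = w_it r k \<omega>; \<eta> = eta_it r k \<omega>; \<Delta> = Delta_it r k \<omega>;
             \<eta>hat = exact_step M R \<alpha> x (m_it r k \<omega>)
         in norm (B x *v w) \<le> \<Delta> \<and>
            norm (w - \<eta>) \<le> C0 * \<Delta> \<and>
            norm (\<eta> - \<eta>hat) \<le> C1 * sqrt \<Delta> \<and>
            norm (w - \<eta>hat) \<le> C2 * sqrt \<Delta>)"
proof -
  \<comment> \<open>Fixed before \<open>n\<close>, \<open>f\<close>, \<open>\<alpha>\<close> and
    \<open>k\<close>. The summand 1 makes \<open>K\<close> positive even if the others vanish; the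
    absolute value keeps it so when no sign of \<open>\<alpha>bar\<close> is known yet.\<close>
  define K where "K = 2 * C0\<^sup>2 * \<Delta>bar + 4 * \<bar>\<alpha>bar\<bar> * \<l>R * C0 + 1"
  have "\<l>R \<ge> 0" by (rule lipschitz_on_nonneg) (rule assms(9))
  have "K > 0" using assms(5,15) \<open>\<l>R \<ge> 0\<close> unfolding K_def by (intro add_nonneg_pos) simp_all
  have ker: "tangent_space M x = {v. B x *v v = 0}" if "x \<in> M" for x
    using defining_jacobian_kernel[OF assms(3) that] assms(4) by simp
  have subT: "subspace (tangent_space M x)" if "x \<in> M" for x
    unfolding ker[OF that]
    by (rule linear_subspace_kernel) (rule matrix_vector_mul_linear)
  \<comment> \<open>A closest point exists because a tangent space is closed and contains 0.\<close>
  have projT: "closest_point (tangent_space M x) w \<in> tangent_space M x" if "x \<in> M" for x w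
    using closest_point_in_set[OF closed_subspace[OF subT[OF that]]] subspace_0[OF subT[OF that]]
    by blast
  show ?thesis
  proof (rule exI[of _ "sqrt K"], intro conjI, use \<open>K > 0\<close> in simp,
      rule exI[of _ "sqrt K"], intro conjI, use \<open>K > 0\<close> in simp, intro allI impI ballI)
    fix n :: nat and f \<alpha> and P :: "'w measure" and H and S :: "'s measure" and est x0 r \<omega> k
    assume "0 < \<alpha>" "\<alpha> \<le> \<alpha>bar" "x0 \<in> M" "\<omega> \<in> space P"
      and run: "irpmvr M Retr B R \<alpha> \<gamma> \<Delta>bar \<chi>bar Mu n f P H S est x0 r"
    have x_0: "x_it r 0 \<omega> = x0"
      and \<Delta>: "Delta_it r j \<omega> \<in> {0..\<Delta>bar}"
      and step: "irpmvr_step M Retr B R \<alpha> Mu est r \<omega> j" for j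
      using run \<open>\<omega> \<in> space P\<close> unfolding irpmvr_def by blast+
    note step' = step[unfolded irpmvr_step_def Let_def]
    \<comment> \<open>The description of the tangent space as a kernel and the bound with
      \<open>C0\<close> hold only at points of \<open>M\<close>.\<close>
    have xM: "x_it r j \<omega> \<in> M" for j
    proof (induction j)
      case 0
      then show ?case using x_0 \<open>x0 \<in> M\<close> by simp
    next
      case (Suc j)
      have "eta_it r j \<omega> \<in> tangent_space M (x_it r j \<omega>)"
        using step'[of j] projT[OF Suc] by simp
      then have "gamma_it r j \<omega> *\<^sub>R eta_it r j \<omega> \<in> tangent_space M (x_it r j \<omega>)"
        by (rule subspace_scale[OF subT[OF Suc]])
      then have "Retr (x_it r j \<omega>) (gamma_it r j \<omega> *\<^sub>R eta_it r j \<omega>) \<in> M"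
        using assms(7) Suc unfolding manifold_retraction_def tangent_bundle_def by blast
      then show ?case using step'[of j] by simp
    qed
    define x where "x = x_it r k \<omega>"
    define m where "m = m_it r k \<omega>"
    define w where "w = w_it r k \<omega>"
    define \<eta> where "\<eta> = eta_it r k \<omega>"
    define \<delta> where "\<delta> = Delta_it r k \<omega>"
    define b where "b = transpose (B x) *v lambda_it r k \<omega>"
    define h where "h = exact_step M R \<alpha> x m"
    define T where "T = tangent_space M x"
    have "x \<in> M" using xM by (simp add: x_def)
    have T: "subspace T" unfolding T_def by (rule subT) fact
    have "0 \<le> \<delta>" "\<delta> \<le> \<Delta>bar" using \<Delta>[of k] by (auto simp: \<delta>_def)
    have grad: "norm (gradient (dual_model R \<alpha> B x m) (lambda_it r k \<omega>)) \<le> \<delta>"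
      and w: "w = prox \<alpha> R (x - \<alpha> *\<^sub>R (m + b)) - x" and \<eta>: "\<eta> = closest_point T w"
      using step'[of k] unfolding x_def m_def w_def \<eta>_def \<delta>_def b_def T_def by blast+
    have wmin: "is_arg_min (step_model R \<alpha> x (m + b)) (\<lambda>\<eta>. \<eta> \<in> UNIV) w"
      unfolding w by (rule prox_step_is_arg_min[OF assms(9) \<open>0 < \<alpha>\<close>])
    have Bw: "norm (B x *v w) \<le> \<delta>"
      using grad gradient_dual_model[where B = B and x = x, OF assms(8,9) \<open>0 < \<alpha>\<close> wmin[unfolded b_def]] by simp
    have "\<eta> \<in> T" unfolding \<eta> T_def by (rule projT) fact
    have "norm (w - \<eta>) = infdist w T"
      unfolding \<eta> using setdist_closest_point[OF closed_subspace[OF T], of w] \<open>\<eta> \<in> T\<close>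
      by (metis dist_norm empty_iff infdist_eq_setdist)
    also have "\<dots> \<le> C0 * norm (B x *v w)" unfolding T_def by (rule assms(6)) fact
    also have "\<dots> \<le> C0 * \<delta>" using Bw assms(5) by simp
    finally have d: "norm (w - \<eta>) \<le> C0 * \<delta>" .
    \<comment> \<open>The range of the transpose is orthogonal to the kernel of
      \<open>B x\<close>.\<close>
    have bT: "inner b z = 0" if "z \<in> T" for z
      using that unfolding T_def ker[OF \<open>x \<in> M\<close>] b_def
      by (simp add: transpose_matrix_vector dot_lmul_matrix)
    have hmin: "is_arg_min (step_model R \<alpha> x m) (\<lambda>\<eta>. \<eta> \<in> T) h"
      unfolding h_def exact_step_def T_def[symmetric]
      using step_model_attains_min[OF assms(9) \<open>0 < \<alpha>\<close> closed_subspace[OF T] subspace_0[OF T]]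
      by (auto intro: is_arg_min_arg_min)
    have "(norm (\<eta> - h))\<^sup>2 + (norm (w - h))\<^sup>2 \<le> 2 * (norm (w - \<eta>))\<^sup>2 + 4 * \<alpha> * \<l>R * norm (w - \<eta>)"
      by (rule inexact_step_error[OF assms(8,9) \<open>0 < \<alpha>\<close> subspace_imp_convex[OF T] \<open>\<eta> \<in> T\<close> bT wmin hmin])
    also have "\<dots> \<le> 2 * (C0 * \<delta>)\<^sup>2 + 4 * \<bar>\<alpha>bar\<bar> * \<l>R * (C0 * \<delta>)"
      using d \<open>\<l>R \<ge> 0\<close> \<open>0 < \<alpha>\<close> \<open>\<alpha> \<le> \<alpha>bar\<close>
      by (intro add_mono mult_mono power_mono) auto
    also have "\<dots> = (2 * C0\<^sup>2 * \<delta> + 4 * \<bar>\<alpha>bar\<bar> * \<l>R * C0) * \<delta>"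
      by (simp add: power2_eq_square algebra_simps)
    \<comment> \<open>One factor \<open>\<delta>\<close> is traded for its bound
      \<open>\<Delta>bar\<close>, leaving an estimate linear in \<open>\<delta>\<close>.\<close>
    also have "\<dots> \<le> K * \<delta>"
      unfolding K_def using \<open>0 \<le> \<delta>\<close> mult_left_mono[OF \<open>\<delta> \<le> \<Delta>bar\<close>, of "2 * C0\<^sup>2"]
      by (intro mult_right_mono) auto
    finally have sum: "(norm (\<eta> - h))\<^sup>2 + (norm (w - h))\<^sup>2 \<le> K * \<delta>" .
    \<comment> \<open>Each square is at most the sum, so the one constant \<open>sqrt K\<close>
      serves both estimates.\<close>
    have "norm (\<eta> - h) \<le> sqrt (K * \<delta>)" "norm (w - h) \<le> sqrt (K * \<delta>)"
      using sum by (auto intro!: real_le_rsqrt simp: add_increasing add_increasing2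
          intro: order_trans[rotated])
    then have "norm (B x *v w) \<le> \<delta> \<and> norm (w - \<eta>) \<le> C0 * \<delta> \<and>
        norm (\<eta> - h) \<le> sqrt K * sqrt \<delta> \<and> norm (w - h) \<le> sqrt K * sqrt \<delta>"
      using Bw d by (simp add: real_sqrt_mult)
    then show "let x = x_it r k \<omega>; w = w_it r k \<omega>; \<eta> = eta_it r k \<omega>; \<Delta> = Delta_it r k \<omega>;
          \<eta>hat = exact_step M R \<alpha> x (m_it r k \<omega>)
        in norm (B x *v w) \<le> \<Delta> \<and> norm (w - \<eta>) \<le> C0 * \<Delta> \<and>
          norm (\<eta> - \<eta>hat) \<le> sqrt K * sqrt \<Delta> \<and> norm (w - \<eta>hat) \<le> sqrt K * sqrt \<Delta>"
      unfolding Let_def x_def m_def w_def \<eta>_def \<delta>_def h_def .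
  qed
qed

end
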